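(* Let $\mathcal{M}$ be a multicategory and let $(A,\bullet)$ be an applicative system in $\mathcal{M}$. Then $(A,\bullet)$ is weakly $\mathbf{Id}$-combinatory complete if and only if it is a $\mathsf{BI}$-algebra.
   Context: A multicategory $\mathcal{M}$ has a set $\mathcal{M}_0$ of objects; sets of morphisms $\mathcal{M}(A_1,\ldots,A_n;B)$ for all $n\in\mathbb{N}$ (including $n=0$, written $\mathcal{M}(;B)$); identities $1_A\in\mathcal{M}(A;A)$; and composition sending $f\in\mathcal{M}(A_1,\ldots,A_n;B)$ and $g_i\in\mathcal{M}(\Gamma_i;A_i)$ ($\Gamma_i$ a finite sequence of objects) to $f\circ(g_1,\ldots,g_n)\in\mathcal{M}(\Gamma_1,\ldots,\Gamma_n;B)$; composition is associative and identities are unital. $A^n$ denotes the sequence of $n$ copies of $A$, and $f^n$ the sequence of $n$ copies of a morphism $f$. A sub-multicategory of $\mathcal{M}$ consists of a subcollection of the objects and, for objects in it, subcollections of the morphism sets, containing the identities of the chosen objects and closed under composition of $\mathcal{M}$. An applicative system $(A,\bullet)$ in $\mathcal{M}$ is an object $A$ with a morphism $\bullet\in\mathcal{M}(A,A;A)$. Iterated application $\bullet^n\in\mathcal{M}(A,A^n;A)$ is defined by $\bullet^0=1_A$, $\bullet^{n+1}=\bullet\circ(\bullet^n,1_A)$. A morphism $f\in\mathcal{M}(A^n;A)$ is $(A,\bullet)$-computable if there is $a\in\mathcal{M}(;A)$ with $\bullet^n\circ(a,1_A^n)=f$. $(A,\bullet)$ is weakly $\mathbf{Id}$-combinatory complete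 if every morphism of the smallest sub-multicategory of $\mathcal{M}$ containing $\bullet\in\mathcal{M}(A,A;A)$ is $(A,\bullet)$-computable. (Here $\mathbf{Id}$ is the club of identity functions; $\mathbf{Id}$-multicategories are just multicategories.) A $\mathsf{B}$ combinator is $\mathsf{B}\in\mathcal{M}(;A)$ with $\bullet^3\circ(\mathsf{B},1_A,1_A,1_A)=\bullet\circ(1_A,\bullet)$. An $\mathsf{I}$ combinator is $\mathsf{I}\in\mathcal{M}(;A)$ with $\bullet\circ(\mathsf{I},1_A)=1_A$. $(A,\bullet)$ is a $\mathsf{BI}$-algebra if it has both a $\mathsf{B}$ and an $\mathsf{I}$ combinator. *)

theory Defs
  imports Main
begin

text \<open>
  The hom-sets are not assumed to be disjoint, so composition takes the typing of its arguments:
  \<open>Comp M \<Gamma>s As B f gs\<close> is the composite of \<open>f \<in> Hom M As B\<close> with the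
  \<open>gs ! i \<in> Hom M (\<Gamma>s ! i) (As ! i)\<close>, an element of \<open>Hom M (concat \<Gamma>s) B\<close>.
\<close>

record ('o, 'm) multicat =
  Obj :: "'o set"
  Hom :: "'o list \<Rightarrow> 'o \<Rightarrow> 'm set"
  Ident :: "'o \<Rightarrow> 'm"
  Comp :: "'o list list \<Rightarrow> 'o list \<Rightarrow> 'o \<Rightarrow> 'm \<Rightarrow> 'm list \<Rightarrow> 'm"

definition Homs :: "('o list \<Rightarrow> 'o \<Rightarrow> 'm set) \<Rightarrow> 'o list list \<Rightarrow> 'o list \<Rightarrow> 'm list set" where
  "Homs H \<Gamma>s As = {gs. length \<Gamma>s = length As \<and> length gs = length As \<and>
     (\<forall>i < length As. gs ! i \<in> H (\<Gamma>s ! i) (As ! i))}"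

text \<open>
  \<open>Hom_Obj\<close> only says that hom-sets at lists or elements outside \<open>Obj M\<close>, which have no
  mathematical meaning, are empty.
\<close>

locale multicategory =
  fixes M :: "('o, 'm) multicat" (structure)
  assumes Hom_Obj: "f \<in> Hom M \<Gamma> B \<Longrightarrow> set \<Gamma> \<subseteq> Obj M \<and> B \<in> Obj M"
    and Ident_in_Hom: "B \<in> Obj M \<Longrightarrow> Ident M B \<in> Hom M [B] B"
    and Comp_in_Hom: "\<lbrakk>f \<in> Hom M As B; gs \<in> Homs (Hom M) \<Gamma>s As\<rbrakk>
      \<Longrightarrow> Comp M \<Gamma>s As B f gs \<in> Hom M (concat \<Gamma>s) B"
    and Comp_assoc: "\<lbrakk>f \<in> Hom M As B; gs \<in> Homs (Hom M) \<Gamma>s As;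
        length \<Delta>ss = length As; length hss = length As;
        \<And>i. i < length As \<Longrightarrow> hss ! i \<in> Homs (Hom M) (\<Delta>ss ! i) (\<Gamma>s ! i)\<rbrakk>
      \<Longrightarrow> Comp M (concat \<Delta>ss) (concat \<Gamma>s) B (Comp M \<Gamma>s As B f gs) (concat hss) =
          Comp M (map concat \<Delta>ss) As B f
            (map (\<lambda>i. Comp M (\<Delta>ss ! i) (\<Gamma>s ! i) (As ! i) (gs ! i) (hss ! i)) [0..<length As])"
    and Comp_Ident_left: "f \<in> Hom M \<Gamma> B \<Longrightarrow> Comp M [\<Gamma>] [B] B (Ident M B) [f] = f"
    and Comp_Ident_right: "f \<in> Hom M As B
      \<Longrightarrow> Comp M (map (\<lambda>C. [C]) As) As B f (map (Ident M) As) = f"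

definition submulticategory ::
    "('o, 'm) multicat \<Rightarrow> 'o set \<Rightarrow> ('o list \<Rightarrow> 'o \<Rightarrow> 'm set) \<Rightarrow> bool" where
  "submulticategory M S H \<longleftrightarrow>
     S \<subseteq> Obj M \<and>
     (\<forall>\<Gamma> B. H \<Gamma> B \<subseteq> Hom M \<Gamma> B) \<and>
     (\<forall>\<Gamma> B f. f \<in> H \<Gamma> B \<longrightarrow> set \<Gamma> \<subseteq> S \<and> B \<in> S) \<and>
     (\<forall>B \<in> S. Ident M B \<in> H [B] B) \<and>
     (\<forall>\<Gamma>s As B f gs. f \<in> H As B \<longrightarrow> gs \<in> Homs H \<Gamma>s As \<longrightarrow>
        Comp M \<Gamma>s As B f gs \<in> H (concat \<Gamma>s) B)"

text \<open>
  Objects and hom-sets of the smallest sub-multicategory containing a morphism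
  \<open>g \<in> Hom M \<Delta> C\<close>, obtained by intersection.
\<close>

definition gen_Obj :: "('o, 'm) multicat \<Rightarrow> 'o list \<Rightarrow> 'o \<Rightarrow> 'm \<Rightarrow> 'o set" where
  "gen_Obj M \<Delta> C g = {B. \<forall>S H. submulticategory M S H \<longrightarrow> g \<in> H \<Delta> C \<longrightarrow> B \<in> S}"

definition gen_Hom ::
    "('o, 'm) multicat \<Rightarrow> 'o list \<Rightarrow> 'o \<Rightarrow> 'm \<Rightarrow> 'o list \<Rightarrow> 'o \<Rightarrow> 'm set" where
  "gen_Hom M \<Delta> C g \<Gamma> B = {f. \<forall>S H. submulticategory M S H \<longrightarrow> g \<in> H \<Delta> C \<longrightarrow> f \<in> H \<Gamma> B}"

lemma (in multicategory) submulticategory_self: "submulticategory M (Obj M) (Hom M)"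
  unfolding submulticategory_def
  using Hom_Obj Ident_in_Hom Comp_in_Hom by blast

lemma (in multicategory) submulticategory_gen:
  assumes g: "g \<in> Hom M \<Delta> C"
  shows "submulticategory M (gen_Obj M \<Delta> C g) (gen_Hom M \<Delta> C g)"
    and "g \<in> gen_Hom M \<Delta> C g \<Delta> C"
proof -
  have sub: "gen_Obj M \<Delta> C g \<subseteq> S" "gen_Hom M \<Delta> C g \<Gamma> B \<subseteq> H \<Gamma> B"
    if "submulticategory M S H" "g \<in> H \<Delta> C" for S H \<Gamma> B
    using that by (auto simp: gen_Obj_def gen_Hom_def)
  have Homs_sub: "Homs (gen_Hom M \<Delta> C g) \<Gamma>s As \<subseteq> Homs H \<Gamma>s As"
    if "submulticategory M S H" "g \<in> H \<Delta> C" for S H \<Gamma>s As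
    using sub(2)[OF that] by (fastforce simp: Homs_def)
  have "set \<Gamma> \<subseteq> gen_Obj M \<Delta> C g \<and> B \<in> gen_Obj M \<Delta> C g" if "f \<in> gen_Hom M \<Delta> C g \<Gamma> B" for f \<Gamma> B
  proof -
    have "set \<Gamma> \<subseteq> S \<and> B \<in> S" if SH: "submulticategory M S H" "g \<in> H \<Delta> C" for S H
    proof -
      have "f \<in> H \<Gamma> B" using \<open>f \<in> gen_Hom M \<Delta> C g \<Gamma> B\<close> sub(2)[OF SH] by blast
      then show ?thesis using SH(1) unfolding submulticategory_def by blast
    qed
    then show ?thesis by (auto simp: gen_Obj_def)
  qed
  moreover have "Ident M B \<in> gen_Hom M \<Delta> C g [B] B" if "B \<in> gen_Obj M \<Delta> C g" for B
    using that by (auto simp: gen_Obj_def gen_Hom_def submulticategory_def)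
  moreover have "Comp M \<Gamma>s As B f gs \<in> gen_Hom M \<Delta> C g (concat \<Gamma>s) B"
    if f: "f \<in> gen_Hom M \<Delta> C g As B" and gs: "gs \<in> Homs (gen_Hom M \<Delta> C g) \<Gamma>s As" for \<Gamma>s As B f gs
  proof -
    have "Comp M \<Gamma>s As B f gs \<in> H (concat \<Gamma>s) B"
      if SH: "submulticategory M S H" "g \<in> H \<Delta> C" for S H
    proof -
      have "f \<in> H As B" "gs \<in> Homs H \<Gamma>s As" using f gs sub(2)[OF SH] Homs_sub[OF SH] by blast+
      then show ?thesis using SH(1) unfolding submulticategory_def by blast
    qed
    then show ?thesis by (simp add: gen_Hom_def)
  qed
  ultimately show "submulticategory M (gen_Obj M \<Delta> C g) (gen_Hom M \<Delta> C g)"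
    using sub[OF submulticategory_self g] unfolding submulticategory_def by blast
  show "g \<in> gen_Hom M \<Delta> C g \<Delta> C" by (simp add: gen_Hom_def)
qed

lemma gen_least:
  assumes "submulticategory M S H" "g \<in> H \<Delta> C"
  shows "gen_Obj M \<Delta> C g \<subseteq> S" and "gen_Hom M \<Delta> C g \<Gamma> B \<subseteq> H \<Gamma> B"
  using assms by (auto simp: gen_Obj_def gen_Hom_def)

definition applicative_system :: "('o, 'm) multicat \<Rightarrow> 'o \<Rightarrow> 'm \<Rightarrow> bool" where
  "applicative_system M A app \<longleftrightarrow> A \<in> Obj M \<and> app \<in> Hom M [A, A] A"

fun iter_app :: "('o, 'm) multicat \<Rightarrow> 'o \<Rightarrow> 'm \<Rightarrow> nat \<Rightarrow> 'm" where
  "iter_app M A app 0 = Ident M A"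
| "iter_app M A app (Suc n) =
     Comp M [A # replicate n A, [A]] [A, A] A app [iter_app M A app n, Ident M A]"

text \<open>A morphism in \<open>Hom M \<Gamma> B\<close> can be computable only if \<open>\<Gamma>\<close> is some \<open>A\<^sup>n\<close> and \<open>B\<close> is \<open>A\<close>.\<close>

definition computable ::
    "('o, 'm) multicat \<Rightarrow> 'o \<Rightarrow> 'm \<Rightarrow> 'o list \<Rightarrow> 'o \<Rightarrow> 'm \<Rightarrow> bool" where
  "computable M A app \<Gamma> B f \<longleftrightarrow>
     (\<exists>n. \<Gamma> = replicate n A \<and> B = A \<and> f \<in> Hom M (replicate n A) A \<and>
       (\<exists>a \<in> Hom M [] A.
          Comp M ([] # replicate n [A]) (A # replicate n A) A
            (iter_app M A app n) (a # replicate n (Ident M A)) = f))"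

definition weakly_Id_combinatory_complete :: "('o, 'm) multicat \<Rightarrow> 'o \<Rightarrow> 'm \<Rightarrow> bool" where
  "weakly_Id_combinatory_complete M A app \<longleftrightarrow>
     (\<forall>\<Gamma> B. \<forall>f \<in> gen_Hom M [A, A] A app \<Gamma> B. computable M A app \<Gamma> B f)"

definition B_combinator :: "('o, 'm) multicat \<Rightarrow> 'o \<Rightarrow> 'm \<Rightarrow> 'm \<Rightarrow> bool" where
  "B_combinator M A app b \<longleftrightarrow> b \<in> Hom M [] A \<and>
     Comp M [[], [A], [A], [A]] [A, A, A, A] A
       (iter_app M A app 3) [b, Ident M A, Ident M A, Ident M A] =
     Comp M [[A], [A, A]] [A, A] A app [Ident M A, app]"

definition I_combinator :: "('o, 'm) multicat \<Rightarrow> 'o \<Rightarrow> 'm \<Rightarrow> 'm \<Rightarrow> bool" where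
  "I_combinator M A app i \<longleftrightarrow> i \<in> Hom M [] A \<and>
     Comp M [[], [A]] [A, A] A app [i, Ident M A] = Ident M A"

definition BI_algebra :: "('o, 'm) multicat \<Rightarrow> 'o \<Rightarrow> 'm \<Rightarrow> bool" where
  "BI_algebra M A app \<longleftrightarrow> (\<exists>b. B_combinator M A app b) \<and> (\<exists>i. I_combinator M A app i)"

end

theory Submission
  imports Defs
begin

text \<open>
  The morphisms of the smallest sub-multicategory containing application are the constant-free
  planar terms, i.e. binary trees whose leaves are the variables in their left-to-right order.
  By induction, each such term \<open>t\<close> in \<open>n\<close> variables has a closed term \<open>c\<close>, built from \<open>B\<close>
  and \<open>I\<close>, with \<open>c y x\<^sub>1 \<dots> x\<^sub>n = y (t x\<^sub>1 \<dots> x\<^sub>n)\<close>; then \<open>c I\<close> computes \<open>t\<close>. For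
  \<open>t = t\<^sub>1 t\<^sub>2\<close> one has \<open>y (t\<^sub>1 t\<^sub>2) = B y t\<^sub>1 t\<^sub>2 = c\<^sub>2 (c\<^sub>1 (B y) x\<^sub>1 \<dots> x\<^sub>m) z\<^sub>1 \<dots> z\<^sub>n\<close>, and
  iterating \<open>B\<close> moves the closed \<open>c\<^sub>2\<close> to the left of the variables without permuting them.
\<close>

section \<open>Planar terms and simultaneous substitution\<close>

datatype (constants: 'c) planar_term =
    Var
  | Const 'c
  | App "'c planar_term" "'c planar_term"

fun num_vars :: "'c planar_term \<Rightarrow> nat" where
  "num_vars Var = 1"
| "num_vars (Const a) = 0"
| "num_vars (App s t) = num_vars s + num_vars t"

text \<open>Variables need no names: the k-th \<open>Var\<close> leaf from the left is the k-th
  variable. Hence \<open>us\<close> is dealt out from left to right.\<close>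

fun subst :: "'c planar_term \<Rightarrow> 'c planar_term list \<Rightarrow> 'c planar_term" where
  "subst Var us = hd us"
| "subst (Const a) us = Const a"
| "subst (App s t) us = App (subst s (take (num_vars s) us)) (subst t (drop (num_vars s) us))"

text \<open>Syntactic counterpart of iterated application; the fresh variables stand to the right of
  those of \<open>s\<close>.\<close>

definition apply_vars :: "nat \<Rightarrow> 'c planar_term \<Rightarrow> 'c planar_term" where
  "apply_vars n = (\<lambda>s. App s Var) ^^ n"

lemma apply_vars_0 [simp]: "apply_vars 0 s = s"
  by (simp add: apply_vars_def)

lemma apply_vars_Suc: "apply_vars (Suc n) s = App (apply_vars n s) Var"
  by (simp add: apply_vars_def)

text \<open>Exposes the variable next to \<open>s\<close> instead of the outermost one, as the
  induction on iterated \<open>B\<close> requires.\<close>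

lemma apply_vars_Suc': "apply_vars (Suc n) s = apply_vars n (App s Var)"
  by (induction n) (simp_all add: apply_vars_Suc)

lemma apply_vars_add: "apply_vars (m + n) s = apply_vars n (apply_vars m s)"
  by (subst add.commute) (simp add: apply_vars_def funpow_add)

lemma num_vars_apply_vars [simp]: "num_vars (apply_vars n s) = num_vars s + n"
  by (induction n) (auto simp: apply_vars_Suc)

lemma constants_apply_vars [simp]: "constants (apply_vars n s) = constants s"
  by (induction n) (auto simp: apply_vars_Suc)

lemma num_vars_subst:
  "length us = num_vars t \<Longrightarrow> num_vars (subst t us) = (\<Sum>u\<leftarrow>us. num_vars u)"
proof (induction t arbitrary: us)
  case Var
  then show ?case by (cases us) auto
next
  case (App s t)
  let ?ss = "take (num_vars s) us" and ?ts = "drop (num_vars s) us"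
  have "num_vars (subst (App s t) us) = (\<Sum>u\<leftarrow>?ss @ ?ts. num_vars u)"
    using App.prems App.IH(1)[of ?ss] App.IH(2)[of ?ts]
    unfolding map_append sum_list_append by simp
  then show ?case by simp
qed auto

lemma constants_subst:
  "length us = num_vars t \<Longrightarrow> constants (subst t us) \<subseteq> constants t \<union> \<Union> (constants ` set us)"
proof (induction t arbitrary: us)
  case Var
  then show ?case by (cases us) auto
next
  case (App s t)
  let ?ss = "take (num_vars s) us" and ?ts = "drop (num_vars s) us"
  have "constants (subst s ?ss) \<subseteq> constants s \<union> \<Union> (constants ` set ?ss)"
    "constants (subst t ?ts) \<subseteq> constants t \<union> \<Union> (constants ` set ?ts)"
    using App.prems by (intro App.IH; simp)+
  moreover have "set ?ss \<subseteq> set us" "set ?ts \<subseteq> set us"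
    by (auto dest: in_set_takeD in_set_dropD)
  ultimately show ?case by auto blast+
qed auto

lemma subst_apply_vars:
  "num_vars s = length us \<Longrightarrow> subst (apply_vars n s) (us @ replicate n Var) = apply_vars n (subst s us)"
proof (induction n)
  case (Suc n)
  \<comment> \<open>The last \<open>Var\<close> is split off because it belongs to the outermost,
    rightmost variable of \<open>apply_vars (Suc n) s\<close>.\<close>
  then have "us @ replicate (Suc n) Var = (us @ replicate n Var) @ [Var]"
    by (simp add: replicate_append_same)
  with Suc show ?case by (simp add: apply_vars_Suc del: replicate_Suc append_assoc)
qed auto

lemma concat_replicates:
  "concat (map (\<lambda>u. replicate (f u) x) us) = replicate (\<Sum>u\<leftarrow>us. f u) x"
  by (induction us) (auto simp: replicate_add)

section \<open>Interpretation of planar terms in the multicategory\<close>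

locale applicative = multicategory M for M :: "('o, 'm) multicat" +
  fixes A :: 'o and app :: 'm
  assumes applicative: "applicative_system M A app"
begin

lemma A_Obj: "A \<in> Obj M" and app_Hom: "app \<in> Hom M [A, A] A"
  using applicative by (auto simp: applicative_system_def)

text \<open>All contexts are powers of \<open>A\<close>, so \<open>num_vars\<close> supplies the
  typing that \<open>Comp\<close> asks for.\<close>

fun interp :: "'m planar_term \<Rightarrow> 'm" where
  "interp Var = Ident M A"
| "interp (Const a) = a"
| "interp (App s t) =
     Comp M [replicate (num_vars s) A, replicate (num_vars t) A] [A, A] A app [interp s, interp t]"

definition wf_term :: "'m planar_term \<Rightarrow> bool" where
  "wf_term t \<longleftrightarrow> constants t \<subseteq> Hom M [] A"

lemma wf_term_simps [simp]:
  "wf_term Var" "wf_term (Const a) \<longleftrightarrow> a \<in> Hom M [] A"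
  "wf_term (App s t) \<longleftrightarrow> wf_term s \<and> wf_term t"
  "wf_term (apply_vars n s) \<longleftrightarrow> wf_term s"
  by (auto simp: wf_term_def)

lemma Homs_pair: "\<lbrakk>f \<in> H \<Gamma> B; g \<in> H \<Delta> C\<rbrakk> \<Longrightarrow> [f, g] \<in> Homs H [\<Gamma>, \<Delta>] [B, C]"
  by (auto simp: Homs_def nth_Cons split: nat.split)

lemma interp_Hom: "wf_term t \<Longrightarrow> interp t \<in> Hom M (replicate (num_vars t) A) A"
proof (induction t)
  case Var
  then show ?case using Ident_in_Hom A_Obj by simp
next
  case (App s t)
  then show ?case
    using Comp_in_Hom[OF app_Hom Homs_pair] by (simp add: replicate_add)
qed auto

lemma interp_Homs:
  "\<forall>u \<in> set us. wf_term u \<Longrightarrow>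
   map interp us \<in> Homs (Hom M) (map (\<lambda>u. replicate (num_vars u) A) us) (replicate (length us) A)"
  by (auto simp: Homs_def interp_Hom)

text \<open>The cases \<open>Var\<close>, \<open>Const\<close> and \<open>App\<close> are the left
  unit law, the right unit law for a nullary morphism, and associativity.\<close>

lemma interp_subst:
  assumes "wf_term t" "\<forall>u \<in> set us. wf_term u" "length us = num_vars t"
  shows "interp (subst t us) =
    Comp M (map (\<lambda>u. replicate (num_vars u) A) us) (replicate (num_vars t) A) A
      (interp t) (map interp us)"
  using assms
proof (induction t arbitrary: us)
  case Var
  then obtain u where "us = [u]" "wf_term u" by (cases us) auto
  then show ?case using Comp_Ident_left interp_Hom by simp
next
  case (Const a)
  then show ?case using Comp_Ident_right[of a "[]" A] by simp
next
  case (App s t)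
  define ss ts where "ss = take (num_vars s) us" and "ts = drop (num_vars s) us"
  have us: "us = ss @ ts" by (simp add: ss_def ts_def)
  have len: "length ss = num_vars s" "length ts = num_vars t"
    using App.prems by (auto simp: ss_def ts_def)
  have wf: "wf_term s" "wf_term t" "\<forall>u \<in> set ss. wf_term u" "\<forall>u \<in> set ts. wf_term u"
    using App.prems us by auto
  let ?ctx = "\<lambda>us. map (\<lambda>u. replicate (num_vars u) A) us"
  let ?\<Gamma>s = "[replicate (num_vars s) A, replicate (num_vars t) A]"
  \<comment> \<open>Associativity with \<open>app\<close> on top, \<open>s\<close> and
    \<open>t\<close> in the middle, and the substituted terms below, grouped as \<open>ss\<close>
    and \<open>ts\<close>.\<close>
  have "Comp M (concat [?ctx ss, ?ctx ts]) (concat ?\<Gamma>s) A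
      (Comp M ?\<Gamma>s [A, A] A app [interp s, interp t]) (concat [map interp ss, map interp ts]) =
    Comp M (map concat [?ctx ss, ?ctx ts]) [A, A] A app
      (map (\<lambda>i. Comp M ([?ctx ss, ?ctx ts] ! i) (?\<Gamma>s ! i) ([A, A] ! i)
        ([interp s, interp t] ! i) ([map interp ss, map interp ts] ! i)) [0..<length [A, A]])"
  proof (rule Comp_assoc[OF app_Hom Homs_pair])
    fix i assume "i < length [A, A]"
    then have "i = 0 \<or> i = 1" by auto
    then show "[map interp ss, map interp ts] ! i \<in> Homs (Hom M) ([?ctx ss, ?ctx ts] ! i) (?\<Gamma>s ! i)"
      using interp_Homs[OF wf(3)] interp_Homs[OF wf(4)] len by auto
  qed (use interp_Hom wf in auto)
  moreover have "subst (App s t) us = App (subst s ss) (subst t ts)"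
    by (simp add: ss_def ts_def)
  ultimately show ?case
    using App.IH(1)[OF wf(1,3) len(1)] App.IH(2)[OF wf(2,4) len(2)] len
    by (simp add: us concat_replicates num_vars_subst replicate_add)
qed

lemma interp_apply_vars_Var: "interp (apply_vars n Var) = iter_app M A app n"
  by (induction n) (auto simp: apply_vars_Suc)

text \<open>The left side is the substitution of \<open>Const a\<close> for the head variable of
  \<open>apply_vars n Var\<close>, and of \<open>Var\<close> for the others.\<close>

lemma iter_app_Comp:
  assumes "a \<in> Hom M [] A"
  shows "Comp M ([] # replicate n [A]) (A # replicate n A) A
      (iter_app M A app n) (a # replicate n (Ident M A)) = interp (apply_vars n (Const a))"
  using interp_subst[of "apply_vars n Var" "Const a # replicate n Var"]
    subst_apply_vars[of Var "[Const a]" n] assms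
  by (simp add: interp_apply_vars_Var)

section \<open>Equations between terms\<close>

text \<open>Arities are compared as well, since \<open>interp\<close> of an application depends on
  \<open>num_vars\<close> of its parts; this makes the relation a congruence.\<close>

definition term_eq :: "'m planar_term \<Rightarrow> 'm planar_term \<Rightarrow> bool" (infix "\<simeq>" 50) where
  "s \<simeq> t \<longleftrightarrow> num_vars s = num_vars t \<and> interp s = interp t"

lemma term_eq_refl [simp]: "s \<simeq> s"
  by (simp add: term_eq_def)

lemma term_eq_trans [trans]: "s \<simeq> t \<Longrightarrow> t \<simeq> u \<Longrightarrow> s \<simeq> u"
  by (simp add: term_eq_def)

lemma term_eq_App: "s \<simeq> s' \<Longrightarrow> t \<simeq> t' \<Longrightarrow> App s t \<simeq> App s' t'"
  by (simp add: term_eq_def)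

lemma term_eq_apply_vars: "s \<simeq> s' \<Longrightarrow> apply_vars n s \<simeq> apply_vars n s'"
  by (induction n) (auto simp: apply_vars_Suc intro: term_eq_App)

text \<open>Lets the combinator equations, which are stated for variables, be used at arbitrary
  terms.\<close>

lemma term_eq_subst:
  assumes "s \<simeq> t" "wf_term s" "wf_term t" "\<forall>u \<in> set us. wf_term u" "length us = num_vars s"
  shows "subst s us \<simeq> subst t us"
  using assms by (simp add: term_eq_def interp_subst num_vars_subst)

lemma B_combinator_iff:
  "B_combinator M A app b \<longleftrightarrow> b \<in> Hom M [] A \<and> apply_vars 3 (Const b) \<simeq> App Var (App Var Var)"
proof -
  \<comment> \<open>The right unit law identifies \<open>app\<close> with the two-leaf term, so the
    right side of the \<open>B\<close> equation is an interpreted term.\<close>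
  have "interp (App Var Var) = app"
    using Comp_Ident_right[OF app_Hom] by simp
  moreover have "App Var Var = apply_vars 1 Var"
    by (simp add: apply_vars_def)
  ultimately show ?thesis
    using iter_app_Comp[of b 3]
    by (auto simp: B_combinator_def term_eq_def eval_nat_numeral)
qed

lemma I_combinator_iff:
  "I_combinator M A app i \<longleftrightarrow> i \<in> Hom M [] A \<and> App (Const i) Var \<simeq> Var"
  by (auto simp: I_combinator_def term_eq_def)

text \<open>The length of the context forces the arity in \<open>computable\<close>, and
  \<open>iter_app_Comp\<close> turns its equation into one between terms.\<close>

lemma computable_interp_iff:
  assumes "wf_term t"
  shows "computable M A app (replicate (num_vars t) A) A (interp t) \<longleftrightarrow>
    (\<exists>a \<in> Hom M [] A. apply_vars (num_vars t) (Const a) \<simeq> t)"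
  using interp_Hom[OF assms] iter_app_Comp
  by (auto simp: computable_def term_eq_def replicate_eq_replicate)

section \<open>The sub-multicategory generated by application\<close>

text \<open>Interpreted constant-free terms form a sub-multicategory containing \<open>app\<close>,
  as composition is substitution; conversely, each is composed from \<open>app\<close> and
  identities.\<close>

lemma gen_Hom_eq:
  "gen_Hom M [A, A] A app \<Gamma> B =
    {f. \<exists>t. constants t = {} \<and> \<Gamma> = replicate (num_vars t) A \<and> B = A \<and> f = interp t}"
  (is "_ = ?H \<Gamma> B")
proof
  have app: "app = interp (App Var Var)"
    using Comp_Ident_right[OF app_Hom] by simp
  have "submulticategory M {A} ?H"
    unfolding submulticategory_def
  proof (intro conjI allI impI ballI)
    show "{A} \<subseteq> Obj M" using A_Obj by simp
    show "?H \<Gamma> B \<subseteq> Hom M \<Gamma> B" for \<Gamma> B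
      using interp_Hom by (auto simp: wf_term_def)
    show "Ident M B \<in> ?H [B] B" if "B \<in> {A}" for B
      using that by (auto intro!: exI[of _ Var])
  next
    fix \<Gamma>s As B f gs
    assume "f \<in> ?H As B" and gs: "gs \<in> Homs ?H \<Gamma>s As"
    then obtain t where t: "constants t = {}" "As = replicate (num_vars t) A" "B = A" "f = interp t"
      by auto
    let ?n = "num_vars t"
    have len: "length \<Gamma>s = ?n" "length gs = ?n"
      using gs t by (auto simp: Homs_def)
    have "\<forall>i<?n. \<exists>u. constants u = {} \<and> \<Gamma>s ! i = replicate (num_vars u) A \<and> gs ! i = interp u"
      using gs t by (auto simp: Homs_def)
    then obtain u where u: "\<And>i. i < ?n \<Longrightarrow>
        constants (u i) = {} \<and> \<Gamma>s ! i = replicate (num_vars (u i)) A \<and> gs ! i = interp (u i)"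
      by metis
    \<comment> \<open>With one representing term chosen for each component of \<open>gs\<close>, the
      composite is represented by \<open>subst t us\<close>.\<close>
    define us where "us = map u [0..<?n]"
    have us: "length us = ?n" "\<forall>v \<in> set us. constants v = {}"
      using u by (auto simp: us_def)
    have "\<Gamma>s = map (\<lambda>v. replicate (num_vars v) A) us" "gs = map interp us"
      using u len by (auto simp: us_def intro!: nth_equalityI)
    moreover have "constants (subst t us) = {}"
      using constants_subst[OF us(1)] t us by auto
    ultimately show "Comp M \<Gamma>s As B f gs \<in> ?H (concat \<Gamma>s) B"
      using t us
      by (auto simp: interp_subst wf_term_def num_vars_subst concat_replicates
          intro!: exI[of _ "subst t us"])
  qed auto
  moreover have "app \<in> ?H [A, A] A"
    using app by (auto intro!: exI[of _ "App Var Var"])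
  ultimately show "gen_Hom M [A, A] A app \<Gamma> B \<subseteq> ?H \<Gamma> B"
    by (rule gen_least(2))
next
  let ?G = "gen_Hom M [A, A] A app"
  have sub: "submulticategory M (gen_Obj M [A, A] A app) ?G" and app: "app \<in> ?G [A, A] A"
    using submulticategory_gen[OF app_Hom] by auto
  have "interp t \<in> ?G (replicate (num_vars t) A) A" if "constants t = {}" for t
    using that
  proof (induction t)
    case Var
    \<comment> \<open>\<open>A\<close> is a generated object because \<open>app\<close> is a
      generated morphism.\<close>
    have "Ident M A \<in> ?G [A] A"
      using sub app unfolding submulticategory_def by blast
    then show ?case by simp
  next
    case (App s t)
    then have "[interp s, interp t] \<in>
        Homs ?G [replicate (num_vars s) A, replicate (num_vars t) A] [A, A]"
      by (simp add: Homs_pair)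
    then have "interp (App s t) \<in>
        ?G (concat [replicate (num_vars s) A, replicate (num_vars t) A]) A"
      using sub app unfolding submulticategory_def interp.simps by blast
    then show ?case by (simp add: replicate_add)
  qed auto
  then show "?H \<Gamma> B \<subseteq> ?G \<Gamma> B" by auto
qed

lemma weakly_Id_combinatory_complete_iff:
  "weakly_Id_combinatory_complete M A app \<longleftrightarrow>
    (\<forall>t. constants t = {} \<longrightarrow> (\<exists>a \<in> Hom M [] A. apply_vars (num_vars t) (Const a) \<simeq> t))"
proof -
  have "weakly_Id_combinatory_complete M A app \<longleftrightarrow>
    (\<forall>t. constants t = {} \<longrightarrow> computable M A app (replicate (num_vars t) A) A (interp t))"
    unfolding weakly_Id_combinatory_complete_def gen_Hom_eq by blast
  then show ?thesis
    by (auto simp: computable_interp_iff wf_term_def)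
qed

section \<open>Closed terms built from \<open>B\<close> and \<open>I\<close>\<close>

context
  fixes b i
  assumes b: "B_combinator M A app b" and i: "I_combinator M A app i"
begin

lemma b_Hom: "b \<in> Hom M [] A" and i_Hom: "i \<in> Hom M [] A"
  using b i by (auto simp: B_combinator_def I_combinator_def)

lemma B_eq:
  assumes "wf_term s" "wf_term t" "wf_term u"
  shows "App (App (App (Const b) s) t) u \<simeq> App s (App t u)"
  using term_eq_subst[of "apply_vars 3 (Const b)" "App Var (App Var Var)" "[s, t, u]"] b assms
  by (simp add: B_combinator_iff apply_vars_def eval_nat_numeral)

lemma I_eq: "wf_term s \<Longrightarrow> App (Const i) s \<simeq> s"
  using term_eq_subst[of "App (Const i) Var" Var "[s]"] i
  by (simp add: I_combinator_iff)

text \<open>The witness is \<open>B (B (... (B f)))\<close> with \<open>n\<close> copies of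
  \<open>B\<close>, each passing one more variable into the argument of \<open>f\<close>.\<close>

lemma ex_iterated_B:
  assumes "wf_term f" "num_vars f = 0"
  shows "\<exists>f'. wf_term f' \<and> num_vars f' = 0 \<and>
    (\<forall>g. wf_term g \<longrightarrow> apply_vars n (App f' g) \<simeq> App f (apply_vars n g))"
proof (induction n)
  case 0
  then show ?case using assms by (auto intro: exI[of _ f])
next
  case (Suc n)
  then obtain f' where f': "wf_term f'" "num_vars f' = 0"
    and eq: "\<And>g. wf_term g \<Longrightarrow> apply_vars n (App f' g) \<simeq> App f (apply_vars n g)"
    by blast
  have "apply_vars (Suc n) (App (App (Const b) f') g) \<simeq> App f (apply_vars (Suc n) g)"
    if g: "wf_term g" for g
  proof -
    \<comment> \<open>Here \<open>B f' g x = f' (g x)\<close>; the induction hypothesis is then used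
      at the open term \<open>g x\<close>.\<close>
    have "apply_vars (Suc n) (App (App (Const b) f') g) \<simeq> apply_vars n (App f' (App g Var))"
      unfolding apply_vars_Suc' using B_eq f' g by (intro term_eq_apply_vars) auto
    also have "\<dots> \<simeq> App f (apply_vars (Suc n) g)"
      unfolding apply_vars_Suc' using eq g by simp
    finally show ?thesis .
  qed
  then show ?case
    using f' b_Hom by (intro exI[of _ "App (Const b) f'"]) auto
qed

text \<open>Quantifying over open \<open>y\<close> matters: \<open>t2\<close> is handled with the
  continuation \<open>B y t1\<close>, which contains the variables of \<open>t1\<close>.\<close>

lemma ex_continuation_term:
  assumes "constants t = {}"
  shows "\<exists>c. wf_term c \<and> num_vars c = 0 \<and>
    (\<forall>y. wf_term y \<longrightarrow> apply_vars (num_vars t) (App c y) \<simeq> App y t)"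
  using assms
proof (induction t)
  case Var
  \<comment> \<open>Since \<open>I y x = y x\<close>, the closed term for a single variable is
    \<open>I\<close>.\<close>
  have "apply_vars 1 (App (Const i) y) \<simeq> App y Var" if "wf_term y" for y
    using that by (simp add: apply_vars_def term_eq_App I_eq)
  then show ?case using i_Hom by (intro exI[of _ "Const i"]) auto
next
  case (App t1 t2)
  have wf: "wf_term t1" "wf_term t2"
    using App.prems by (auto simp: wf_term_def)
  obtain c1 where c1: "wf_term c1" "num_vars c1 = 0"
    and eq1: "\<And>y. wf_term y \<Longrightarrow> apply_vars (num_vars t1) (App c1 y) \<simeq> App y t1"
    using App by auto
  obtain c2 where c2: "wf_term c2" "num_vars c2 = 0"
    and eq2: "\<And>y. wf_term y \<Longrightarrow> apply_vars (num_vars t2) (App c2 y) \<simeq> App y t2"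
    using App by auto
  obtain d where d: "wf_term d" "num_vars d = 0"
    and eqd: "\<And>g. wf_term g \<Longrightarrow>
      apply_vars (num_vars t1) (App d g) \<simeq> App c2 (apply_vars (num_vars t1) g)"
    using ex_iterated_B[OF c2] by blast
  let ?B = "Const b"
  \<comment> \<open>Both outer uses of \<open>B\<close> are composition:
    \<open>c y = d (c1 (B y))\<close>. The iterated \<open>B\<close> inside \<open>d\<close> then
    lets \<open>c2\<close> wait for the variables of \<open>t1\<close>.\<close>
  let ?c = "App (App ?B d) (App (App ?B c1) ?B)"
  have "apply_vars (num_vars t1 + num_vars t2) (App ?c y) \<simeq> App y (App t1 t2)"
    if y: "wf_term y" for y
  proof -
    have "App ?c y \<simeq> App d (App (App (App ?B c1) ?B) y)"
      using y c1 d b_Hom by (intro B_eq) auto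
    also have "\<dots> \<simeq> App d (App c1 (App ?B y))"
      using y c1 b_Hom by (intro term_eq_App term_eq_refl B_eq) auto
    finally have "apply_vars (num_vars t1) (App ?c y) \<simeq>
        apply_vars (num_vars t1) (App d (App c1 (App ?B y)))"
      by (rule term_eq_apply_vars)
    also have "\<dots> \<simeq> App c2 (apply_vars (num_vars t1) (App c1 (App ?B y)))"
      using y c1 b_Hom by (intro eqd) auto
    also have "\<dots> \<simeq> App c2 (App (App ?B y) t1)"
      using y b_Hom by (intro term_eq_App term_eq_refl eq1) auto
    finally have "apply_vars (num_vars t1 + num_vars t2) (App ?c y) \<simeq>
        apply_vars (num_vars t2) (App c2 (App (App ?B y) t1))"
      unfolding apply_vars_add by (rule term_eq_apply_vars)
    also have "\<dots> \<simeq> App (App (App ?B y) t1) t2"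
      using y wf b_Hom by (intro eq2) auto
    also have "\<dots> \<simeq> App y (App t1 t2)"
      using y wf by (intro B_eq) auto
    finally show ?thesis .
  qed
  then show ?case
    using c1 d b_Hom by (intro exI[of _ ?c]) auto
qed auto

lemma BI_computes:
  assumes "constants t = {}"
  shows "\<exists>a \<in> Hom M [] A. apply_vars (num_vars t) (Const a) \<simeq> t"
proof -
  obtain c where c: "wf_term c" "num_vars c = 0"
    and eq: "apply_vars (num_vars t) (App c (Const i)) \<simeq> App (Const i) t"
    using ex_continuation_term[OF assms] i_Hom by auto
  \<comment> \<open>The continuation \<open>I\<close> returns \<open>t\<close> itself. The closed
    term \<open>c I\<close> is collapsed into one constant, since computability asks for an element
    of \<open>Hom M [] A\<close>.\<close>
  let ?a = "interp (App c (Const i))"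
  have "?a \<in> Hom M [] A"
    using interp_Hom[of "App c (Const i)"] c i_Hom by simp
  moreover have "apply_vars (num_vars t) (Const ?a) \<simeq> t"
  proof -
    have "Const ?a \<simeq> App c (Const i)"
      using c by (simp add: term_eq_def)
    then have "apply_vars (num_vars t) (Const ?a) \<simeq> apply_vars (num_vars t) (App c (Const i))"
      by (rule term_eq_apply_vars)
    also note eq
    also have "App (Const i) t \<simeq> t"
      using assms by (intro I_eq) (simp add: wf_term_def)
    finally show ?thesis .
  qed
  ultimately show ?thesis by blast
qed

end

lemma weakly_Id_combinatory_complete_iff_BI_algebra:
  "weakly_Id_combinatory_complete M A app \<longleftrightarrow> BI_algebra M A app"
proof
  assume "weakly_Id_combinatory_complete M A app"
  then have comp: "\<exists>a \<in> Hom M [] A. apply_vars (num_vars t) (Const a) \<simeq> t" if "constants t = {}" for t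
    using that by (simp add: weakly_Id_combinatory_complete_iff)
  show "BI_algebra M A app"
    \<comment> \<open>The term \<open>x (y z)\<close> yields \<open>B\<close>, and the term
      \<open>x\<close> yields \<open>I\<close>.\<close>
    using comp[of "App Var (App Var Var)"] comp[of Var]
    by (auto simp: BI_algebra_def B_combinator_iff I_combinator_iff apply_vars_def eval_nat_numeral)
next
  assume "BI_algebra M A app"
  then show "weakly_Id_combinatory_complete M A app"
    using BI_computes by (auto simp: BI_algebra_def weakly_Id_combinatory_complete_iff)
qed

end

theorem theorem3p7:
  fixes M :: "('o, 'm) multicat" and A :: 'o and app :: 'm
  assumes "multicategory M" and "applicative_system M A app"
  shows "weakly_Id_combinatory_complete M A app \<longleftrightarrow> BI_algebra M A app"
proof -
  interpret applicative M A app
    using assms by (simp add: applicative_def applicative_axioms_def)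
  show ?thesis by (rule weakly_Id_combinatory_complete_iff_BI_algebra)
qed

end
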